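(* No online algorithm with advice for the proportional removable knapsack problem \textsc{RemKnap} that reads only a single advice bit has a (strict) competitive ratio better than $(1+\sqrt{17})/4$.
   Context: \textsc{RemKnap} (proportional removable knapsack) is the following online maximization problem. An instance is a sequence of items $1,\dots,n$ with sizes $s_1,\dots,s_n\in\mathbb{R}_{>0}$; the knapsack has capacity $1$. For a set $A$ of items, $s(A)=\sum_{i\in A}s_i$. The items are revealed one by one; the algorithm starts with the empty packing $A_0=\emptyset$, and when item $i$ is revealed (and only then does it learn $s_i$) it must choose a new packing $A_i\subseteq A_{i-1}\cup\{i\}$ with $s(A_i)\le 1$. Thus it may remove any previously packed items and may pack the new item, but a removed or rejected item can never be packed again. The algorithm learns $n$ only after choosing $A_n$. The gain is $\mathrm{ALG}(I)=s(A_n)$; $\mathrm{OPT}(I)$ is the maximum of $s(A)$ over all subsets $A$ of the items with $s(A)\le1$. In the advice model, an omniscient oracle that knows the whole instance writes a binary advice string that the algorithm may read. An algorithm is strictly $\rho$-competitive if $\mathrm{OPT}(I)/\mathrm{ALG}(I)\le\rho$ for every instance $I$; its strict competitive ratio is the infimum of all such $\rho$. *)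

theory Defs
  imports "HOL-Library.Extended_Real"
begin

text \<open>
  An instance is the list of item sizes in order of arrival; items are identified with
  their positions in this list, counted from 0. A packing is a set of positions.
\<close>

definition is_instance :: "real list \<Rightarrow> bool" where
  "is_instance I \<longleftrightarrow> (\<forall>s \<in> set I. 0 < s)"

definition total_size :: "real list \<Rightarrow> nat set \<Rightarrow> real" where
  "total_size I X = (\<Sum>i\<in>X. I ! i)"

definition OPT :: "real list \<Rightarrow> real" where
  "OPT I = Max {total_size I X | X. X \<subseteq> {..<length I} \<and> total_size I X \<le> 1}"

text \<open>
  The advice is an infinite bit tape, so that its length carries no information.
  An algorithm maps the tape and the sizes revealed so far to its current packing:
  \<open>A \<phi> [s\<^sub>1, \<dots>, s\<^sub>i]\<close> is the packing chosen on arrival of the \<open>i\<close>-th item.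
  Since the algorithm is deterministic, its earlier packings are determined by the same data.
\<close>

type_synonym advice = "nat \<Rightarrow> bool"
type_synonym algorithm = "advice \<Rightarrow> real list \<Rightarrow> nat set"
type_synonym oracle_fun = "real list \<Rightarrow> advice"

text \<open>The item arriving after the prefix \<open>p\<close> has position \<open>length p\<close>.\<close>

definition online_algorithm :: "algorithm \<Rightarrow> bool" where
  "online_algorithm A \<longleftrightarrow>
     (\<forall>\<phi>. A \<phi> [] = {} \<and>
       (\<forall>p s. is_instance (p @ [s]) \<longrightarrow>
          A \<phi> (p @ [s]) \<subseteq> A \<phi> p \<union> {length p} \<and>
          total_size (p @ [s]) (A \<phi> (p @ [s])) \<le> 1))"

text \<open>
  The tape is read from left to right, so reading at most \<open>b\<close> bits means that, during the
  run on \<open>I\<close> with the advice supplied for \<open>I\<close>, changing the tape beyond the first \<open>b\<close>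
  bits does not affect any decision.
\<close>

definition reads_at_most :: "nat \<Rightarrow> algorithm \<Rightarrow> oracle_fun \<Rightarrow> bool" where
  "reads_at_most b A adv \<longleftrightarrow>
     (\<forall>I \<psi>. is_instance I \<and> (\<forall>j<b. \<psi> j = adv I j) \<longrightarrow>
        (\<forall>m\<le>length I. A \<psi> (take m I) = A (adv I) (take m I)))"

definition gain :: "algorithm \<Rightarrow> oracle_fun \<Rightarrow> real list \<Rightarrow> real" where
  "gain A adv I = total_size I (A (adv I) I)"

text \<open>
  The quotient is taken in \<^typ>\<open>ereal\<close>, where it is \<open>\<infinity>\<close> if the gain is 0 and the optimum is
  positive (on the reals it would be 0), and 0 if both are 0, so that instances without any
  packable item impose no constraint.
\<close>

definition strictly_competitive :: "algorithm \<Rightarrow> oracle_fun \<Rightarrow> ereal \<Rightarrow> bool" where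
  "strictly_competitive A adv \<rho> \<longleftrightarrow>
     (\<forall>I. is_instance I \<longrightarrow> ereal (OPT I) / ereal (gain A adv I) \<le> \<rho>)"

definition strict_competitive_ratio :: "algorithm \<Rightarrow> oracle_fun \<Rightarrow> ereal" where
  "strict_competitive_ratio A adv = Inf {\<rho>. strictly_competitive A adv \<rho>}"

end

theory Submission
  imports Defs
begin

text \<open>
  A single advice bit leaves two deterministic algorithms, and an instance on which both are
  bad refutes competitiveness. Let \<open>r = (sqrt 17 - 1) / 4\<close> be the inverse of the bound, so that
  \<open>r\<^sup>2 = 1 - r / 2\<close>, and reveal items of sizes \<open>r / 2 + \<epsilon>\<close>, \<open>r\<^sup>2\<close> and \<open>r\<close>. No two of them
  fit together, so each algorithm holds at most one. If neither holds \<open>r\<close>, stop: the gains are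
  at most \<open>r\<^sup>2\<close>, while the optimum is at least \<open>r\<close>. Otherwise one of the first two items is held by
  neither algorithm. Reveal its complement to \<open>1\<close>; the optimum is then \<open>1\<close>, but both gains are
  at most \<open>r + \<epsilon>\<close>.
\<close>

lemma total_size_le_OPT:
  assumes "X \<subseteq> {..<length I}" and "total_size I X \<le> 1"
  shows "total_size I X \<le> OPT I"
proof -
  have "{total_size I X | X. X \<subseteq> {..<length I} \<and> total_size I X \<le> 1}
      \<subseteq> total_size I ` Pow {..<length I}"
    by auto
  then have "finite {total_size I X | X. X \<subseteq> {..<length I} \<and> total_size I X \<le> 1}"
    by (rule finite_subset) simp
  then show ?thesis
    unfolding OPT_def using assms by (intro Max_ge) auto
qed

text \<open>Membership tests over all positions turn the size of an unknown packing of a concrete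
  list into a finite case split with linear arithmetic.\<close>

lemma total_size_eq_if_sum:
  assumes "X \<subseteq> {..<length I}"
  shows "total_size I X = (\<Sum>i<length I. if i \<in> X then I ! i else 0)"
proof -
  have "total_size I X = (\<Sum>i\<in>{..<length I} \<inter> X. I ! i)"
    using assms by (simp add: total_size_def Int_absorb1)
  then show ?thesis
    by (simp add: sum.inter_restrict)
qed

lemma total_size_nonneg:
  assumes "is_instance I" and "X \<subseteq> {..<length I}"
  shows "0 \<le> total_size I X"
  unfolding total_size_def
  using assms by (intro sum_nonneg) (force simp: is_instance_def intro: less_imp_le)

lemma online_packing_subset:
  assumes "online_algorithm A" and "is_instance I"
  shows "A \<phi> I \<subseteq> {..<length I}"
  using assms(2)
proof (induction I rule: rev_induct)
  case Nil
  then show ?case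
    using assms(1) by (simp add: online_algorithm_def)
next
  case (snoc s p)
  then have "A \<phi> (p @ [s]) \<subseteq> A \<phi> p \<union> {length p}" and "A \<phi> p \<subseteq> {..<length p}"
    using assms(1) by (auto simp: online_algorithm_def is_instance_def)
  then show ?case
    by (auto simp: less_Suc_eq)
qed

text \<open>Only the first bit matters, so the tape may be replaced by a constant one. The oracle
  then merely selects between two fixed algorithms, and an instance that is bad for both constant
  tapes is bad whatever it writes.\<close>

lemma gain_one_bit:
  assumes "reads_at_most 1 A adv" and "is_instance I"
  shows "gain A adv I = total_size I (A (\<lambda>_. adv I 0) I)"
proof -
  have "A (\<lambda>_. adv I 0) (take (length I) I) = A (adv I) (take (length I) I)"
    using assms unfolding reads_at_most_def by (metis less_one order_refl)
  then show ?thesis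
    by (simp add: gain_def)
qed

lemma hard_instance_exists:
  fixes A :: algorithm and r \<epsilon> :: real
  assumes A: "online_algorithm A"
    and r: "r\<^sup>2 = 1 - r / 2" "3/4 < r" "r < 4/5"
    and \<epsilon>: "0 < \<epsilon>" "\<epsilon> < 1/10"
  obtains I c where "is_instance I" "0 < c" "c \<le> OPT I"
    "\<And>b. total_size I (A (\<lambda>_. b) I) \<le> (r + \<epsilon>) * c"
proof -
  define I where "I = [r / 2 + \<epsilon>, 1 - r / 2, r]"
  define P where "P b = A (\<lambda>_. b) I" for b
  have I: "is_instance I" "length I = 3"
    using r \<epsilon> by (auto simp: I_def is_instance_def)
  have P_subset: "P b \<subseteq> {..<3}" for b
    using online_packing_subset[OF A I(1)] I(2) by (simp add: P_def)
  have P_le: "total_size I (P b) \<le> 1" for b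
    using A I(1) unfolding online_algorithm_def P_def I_def
    by (metis append_Cons append_Nil)
  have P_size: "total_size I (P b) = (if 0 \<in> P b then r / 2 + \<epsilon> else 0) +
      (if 1 \<in> P b then 1 - r / 2 else 0) + (if 2 \<in> P b then r else 0)" for b
    using total_size_eq_if_sum[of "P b" I] P_subset[of b] I(2)
    by (simp add: I_def numeral_eq_Suc)
  \<comment> \<open>The pairs have sizes \<open>1 + \<epsilon>\<close>,
    \<open>3 * r / 2 + \<epsilon>\<close> and \<open>1 + r / 2\<close>; the first is why
    \<open>\<epsilon>\<close> must be positive.\<close>
  have single: "\<not> (0 \<in> P b \<and> 1 \<in> P b)" "\<not> (0 \<in> P b \<and> 2 \<in> P b)"
    "\<not> (1 \<in> P b \<and> 2 \<in> P b)" for b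
    using P_le[of b] r \<epsilon> unfolding P_size by (auto split: if_splits)
  show thesis
  proof (cases "\<exists>b. 2 \<in> P b")
    case False
    have "r \<le> OPT I"
      using total_size_le_OPT[of "{2}" I] r I(2) by (simp add: total_size_def I_def)
    moreover have "total_size I (A (\<lambda>_. b) I) \<le> (r + \<epsilon>) * r" for b
    proof -
      have "total_size I (P b) \<le> 1 - r / 2"
        using False single(1)[of b] r \<epsilon> unfolding P_size by auto
      also have "\<dots> = r * r"
        using r(1) by (simp add: power2_eq_square)
      also have "\<dots> \<le> (r + \<epsilon>) * r"
        using r \<epsilon> by (intro mult_right_mono) auto
      finally show ?thesis
        by (simp add: P_def)
    qed
    ultimately show thesis
      using that[of I r] I(1) r by simp
  next
    case True
    then obtain b where "2 \<in> P b" ..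
    then have "0 \<notin> P b" "1 \<notin> P b"
      using single by blast+
    \<comment> \<open>Tape \<open>b\<close> holds neither item 0 nor item 1, and the opposite tape
      holds at most one of them.\<close>
    then have "(\<forall>b. 0 \<notin> P b) \<or> (\<forall>b. 1 \<notin> P b)"
      using single(1)[of "\<not> b"] by (cases b) (auto simp: all_bool_eq)
    then obtain k where k: "k = 0 \<or> k = 1" "\<And>b. k \<notin> P b"
      by blast
    define x where "x = 1 - I ! k"
    define J where "J = I @ [x]"
    define Q where "Q b = A (\<lambda>_. b) J" for b
    have x: "k = 0 \<and> x = 1 - (r / 2 + \<epsilon>) \<or> k = 1 \<and> x = r / 2"
      using k(1) by (auto simp: x_def I_def)
    have J: "is_instance J" "length J = 4"
      using I x r \<epsilon> by (auto simp: J_def is_instance_def)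
    have Q: "Q b \<subseteq> P b \<union> {3}" "total_size J (Q b) \<le> 1" for b
      using A J(1) I(2) unfolding online_algorithm_def Q_def P_def J_def by metis+
    have Q_subset: "Q b \<subseteq> {..<4}" for b
      using Q(1)[of b] P_subset[of b] by fastforce
    have Q_size: "total_size J (Q b) = (if 0 \<in> Q b then r / 2 + \<epsilon> else 0) +
        (if 1 \<in> Q b then 1 - r / 2 else 0) + (if 2 \<in> Q b then r else 0) +
        (if 3 \<in> Q b then x else 0)" for b
      using total_size_eq_if_sum[of "Q b" J] Q_subset[of b] J(2)
      by (simp add: J_def I_def numeral_eq_Suc)
    have "total_size J {k, 3} = 1"
      using x by (auto simp: total_size_def J_def I_def)
    then have "1 \<le> OPT J"
      using total_size_le_OPT[of "{k, 3}" J] J(2) k(1) by auto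
    moreover have "total_size J (A (\<lambda>_. b) J) \<le> (r + \<epsilon>) * 1" for b
    proof -
      have sub: "i \<in> Q b \<Longrightarrow> i \<noteq> 3 \<Longrightarrow> i \<in> P b" for i
        using Q(1) by blast
      have k_notin: "k \<notin> Q b"
        using sub[of k] k by auto
      have Q_single: "\<not> (0 \<in> Q b \<and> 1 \<in> Q b)" "\<not> (0 \<in> Q b \<and> 2 \<in> Q b)"
        "\<not> (1 \<in> Q b \<and> 2 \<in> Q b)"
        using single[of b] sub by auto
      \<comment> \<open>If \<open>k = 0\<close>, the last item fits with no other item that may
        still be held, and alone it is smaller than \<open>r\<close>. If \<open>k = 1\<close>, it
        fits only with item 0, which gives exactly \<open>r + \<epsilon>\<close>.\<close>
      have "total_size J (Q b) \<le> r + \<epsilon>"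
        using Q(2)[of b] Q_single k_notin x r \<epsilon> unfolding Q_size
        by (auto split: if_splits)
      then show ?thesis
        by (simp add: Q_def)
    qed
    ultimately show thesis
      using that[of J 1] J(1) by simp
  qed
qed

lemma ereal_divide_le_ereal_divide:
  fixes a b c d :: real
  assumes "0 < c" "c \<le> a" "0 \<le> b" "b \<le> d * c" "0 < d"
  shows "ereal (1 / d) \<le> ereal a / ereal b"
proof (cases "b = 0")
  case True
  \<comment> \<open>Here the quotient is infinite, since \<open>a\<close> is positive.\<close>
  then show ?thesis
    using assms by (simp add: divide_ereal_def)
next
  case False
  have "b \<le> d * a"
    using assms by (meson mult_left_mono less_imp_le order_trans)
  then have "1 / d \<le> a / b"
    using False assms by (simp add: field_simps)
  then show ?thesis
    using False by simp
qed

theorem theorem5: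
  fixes A :: algorithm and adv :: oracle_fun
  assumes "online_algorithm A" and "reads_at_most 1 A adv"
  shows "ereal ((1 + sqrt 17) / 4) \<le> strict_competitive_ratio A adv"
proof -
  define r where "r = (sqrt 17 - 1) / 4"
  have sqrt17: "4 < sqrt 17" "sqrt 17 < 42/10"
    by (rule real_less_rsqrt real_less_lsqrt; simp add: power2_eq_square)+
  then have r: "r\<^sup>2 = 1 - r / 2" "3/4 < r" "r < 4/5"
    by (auto simp: r_def power2_eq_square field_simps)
  \<comment> \<open>This rests on \<open>(sqrt 17 - 1) * (sqrt 17 + 1) = 16\<close>.\<close>
  have inverse: "(1 + sqrt 17) / 4 = 1 / r"
    using sqrt17 by (simp add: r_def field_simps)
  have "ereal (1 / r) \<le> \<rho>" if \<rho>: "strictly_competitive A adv \<rho>" for \<rho>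
  proof -
    have bound: "ereal (1 / (r + \<epsilon>)) \<le> \<rho>" if \<epsilon>: "0 < \<epsilon>" "\<epsilon> < 1/10" for \<epsilon>
    proof -
      obtain I c where I: "is_instance I" "0 < c" "c \<le> OPT I"
        "\<And>b. total_size I (A (\<lambda>_. b) I) \<le> (r + \<epsilon>) * c"
        using hard_instance_exists[OF assms(1) r \<epsilon>] by blast
      have "0 \<le> gain A adv I" "gain A adv I \<le> (r + \<epsilon>) * c"
        using gain_one_bit[OF assms(2) I(1)] I(4)
          total_size_nonneg[OF I(1) online_packing_subset[OF assms(1) I(1)]] by auto
      then have "ereal (1 / (r + \<epsilon>)) \<le> ereal (OPT I) / ereal (gain A adv I)"
        using I r(2) \<epsilon> by (intro ereal_divide_le_ereal_divide) auto
      also have "\<dots> \<le> \<rho>"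
        using \<rho> I(1) by (simp add: strictly_competitive_def)
      finally show ?thesis .
    qed
    \<comment> \<open>Each hard instance only yields \<open>1 / (r + \<epsilon>)\<close>; the exact
      constant appears as \<open>\<epsilon>\<close> tends to 0 from above.\<close>
    have "((\<lambda>\<epsilon>. ereal (1 / (r + \<epsilon>))) \<longlongrightarrow> ereal (1 / (r + 0))) (at_right 0)"
      using r(2) by (intro tendsto_intros) auto
    moreover have "\<forall>\<^sub>F \<epsilon> in at_right 0. ereal (1 / (r + \<epsilon>)) \<le> \<rho>"
      using bound by (auto simp: eventually_at_right_field intro!: exI[of _ "1/10"])
    ultimately show ?thesis
      using tendsto_upperbound[OF _ _ trivial_limit_at_right_real] by fastforce
  qed
  then show ?thesis
    unfolding strict_competitive_ratio_def inverse by (intro Inf_greatest) simp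
qed

end
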